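(* Let $\varphi:\mathbb{C}^{m}\to\mathbb{C}^{n}$ be a holomorphic map, written as $\varphi(X+iY)=\phi(X,Y)+i\psi(X,Y)$ with $X,Y\in\mathbb{R}^m$ and $\phi,\psi:\mathbb{R}^{2m}\to\mathbb{R}^{n}$ its real and imaginary parts. Then $\varphi$ is $\infty$-harmonic (as a map $\mathbb{R}^{2m}\to\mathbb{R}^{2n}$) if and only if its real and imaginary parts $\phi(X,Y)$ and $\psi(X,Y)$ are $\infty$-harmonic (as maps $\mathbb{R}^{2m}\to\mathbb{R}^n$).
   Context: A smooth map $\varphi:(M,g)\to(N,h)$ between Riemannian manifolds is called $\infty$-harmonic if $\tfrac12\,{\rm d}\varphi({\rm grad}\,|{\rm d}\varphi|^2)=0$ on $M$, where $|{\rm d}\varphi|^2={\rm Trace}_g\,\varphi^*h$ is the energy density of $\varphi$ and the gradient is taken with respect to $g$. All real spaces carry their standard Euclidean metrics. A map $\varphi:\mathbb{C}^m\to\mathbb{C}^n$, with $z_j=x_j+iy_j$ on the domain and $w_\alpha=u_\alpha+iv_\alpha$ on the target, is regarded as the map $\mathbb{R}^{2m}\to\mathbb{R}^{2n}$, $(x_1,\ldots,x_m,y_1,\ldots,y_m)\mapsto(u_1,\ldots,u_n,v_1,\ldots,v_n)$; then $X=(x_1,\ldots,x_m)$, $Y=(y_1,\ldots,y_m)$, $\phi=(u_1,\ldots,u_n)$ and $\psi=(v_1,\ldots,v_n)$. *)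

theory Defs
  imports "HOL-Analysis.Analysis"
begin

text \<open>
  The real space of dimension \<open>2m\<close> with coordinates \<open>(x\<^sub>1, \<dots>, x\<^sub>m, y\<^sub>1, \<dots>, y\<^sub>m)\<close> is the
  product type \<open>(real ^ 'm) \<times> (real ^ 'm)\<close>, whose inner product
  \<open>(X, Y) \<bullet> (X', Y') = X \<bullet> X' + Y \<bullet> Y'\<close> is the standard one.
\<close>

definition cvec :: "(real ^ 'm) \<times> (real ^ 'm) \<Rightarrow> complex ^ 'm" where
  "cvec p = (\<chi> j. complex_of_real (fst p $ j) + \<i> * complex_of_real (snd p $ j))"

definition rvec :: "complex ^ 'n \<Rightarrow> (real ^ 'n) \<times> (real ^ 'n)" where
  "rvec w = ((\<chi> \<alpha>. Re (w $ \<alpha>)), (\<chi> \<alpha>. Im (w $ \<alpha>)))"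

definition realify ::
  "(complex ^ 'm \<Rightarrow> complex ^ 'n) \<Rightarrow> (real ^ 'm) \<times> (real ^ 'm) \<Rightarrow> (real ^ 'n) \<times> (real ^ 'n)" where
  "realify F = rvec \<circ> F \<circ> cvec"

text \<open>
  Complex differentiability in several variables: the Frechet derivative exists at every
  point and is complex linear. (The library's \<open>holomorphic_on\<close> is for one variable only;
  additivity of \<open>F'\<close> is part of \<open>has_derivative\<close>.)
\<close>

definition holomorphic_map :: "(complex ^ 'm \<Rightarrow> complex ^ 'n) \<Rightarrow> bool" where
  "holomorphic_map F \<longleftrightarrow>
     (\<forall>z. \<exists>F'. (F has_derivative F') (at z) \<and> (\<forall>c v. F' (c *s v) = c *s F' v))"

text \<open>
  \<open>f\<close> is of class \<open>C\<^sup>k\<close>. In finite dimensions it suffices to require the directional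
  derivatives \<open>x \<mapsto> df\<^sub>x(v)\<close> to be of class \<open>C\<^sup>k\<^sup>-\<^sup>1\<close> for each fixed \<open>v\<close>.
\<close>

primrec times_differentiable ::
  "nat \<Rightarrow> ('a::euclidean_space \<Rightarrow> 'b::euclidean_space) \<Rightarrow> bool" where
  "times_differentiable 0 f \<longleftrightarrow> continuous_on UNIV f"
| "times_differentiable (Suc k) f \<longleftrightarrow>
     (\<forall>x. f differentiable (at x)) \<and>
     (\<forall>v. times_differentiable k (\<lambda>x. frechet_derivative f (at x) v))"

definition smooth_map :: "('a::euclidean_space \<Rightarrow> 'b::euclidean_space) \<Rightarrow> bool" where
  "smooth_map f \<longleftrightarrow> (\<forall>k. times_differentiable k f)"

text \<open>
  The trace of the pulled-back metric \<open>(v, w) \<mapsto> df(v) \<bullet> df(w)\<close>, computed in the standard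
  orthonormal basis of the domain.
\<close>

definition energy_density :: "('a::euclidean_space \<Rightarrow> 'b::euclidean_space) \<Rightarrow> 'a \<Rightarrow> real" where
  "energy_density f x =
     (\<Sum>b\<in>Basis. frechet_derivative f (at x) b \<bullet> frechet_derivative f (at x) b)"

text \<open>Meaningful where \<open>h\<close> is differentiable; \<open>GDERIV h x :> D\<close> says \<open>dh(v) = v \<bullet> D\<close> at \<open>x\<close>.\<close>

definition grad :: "('a::euclidean_space \<Rightarrow> real) \<Rightarrow> 'a \<Rightarrow> 'a" where
  "grad h x = (THE D. GDERIV h x :> D)"

definition infinity_harmonic :: "('a::euclidean_space \<Rightarrow> 'b::euclidean_space) \<Rightarrow> bool" where
  "infinity_harmonic f \<longleftrightarrow>
     smooth_map f \<and>
     (\<forall>x. (1/2) *\<^sub>R frechet_derivative f (at x) (grad (energy_density f) x) = 0)"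

end

theory Submission
  imports Defs
begin

text \<open>
  The Cauchy--Riemann equations say that \<open>d\<psi> = - d\<phi> \<circ> J\<close> for the complex structure \<open>J\<close>, which permutes
  the standard basis up to sign; hence \<open>\<phi>\<close> and \<open>\<psi>\<close> have the same energy density, which is
  half of that of \<open>(\<phi>, \<psi>)\<close>. So the three gradients are proportional, and the equation for
  \<open>(\<phi>, \<psi>)\<close> is, up to a factor of two, the conjunction of the equations for \<open>\<phi>\<close> and \<open>\<psi>\<close>.
\<close>

lemma linear_cvec: "linear cvec"
  by (rule linearI) (simp_all add: cvec_def vec_eq_iff algebra_simps complex_eq_iff)

lemma linear_rvec: "linear rvec"
  by (rule linearI) (simp_all add: rvec_def prod_eq_iff vec_eq_iff)

lemma rvec_cvec [simp]: "rvec (cvec p) = p"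
  by (simp add: rvec_def cvec_def prod_eq_iff vec_eq_iff)

text \<open>The map \<open>(X, Y)\<close> to \<open>(- Y, X)\<close> is the complex structure J in
  real coordinates, since i(X + iY) = - Y + iX.\<close>

lemma cvec_rotate: "cvec (- Y, X) = \<i> *s cvec (X, Y)"
  by (simp add: cvec_def vec_eq_iff complex_eq_iff)

lemma frechet_derivative_Pair:
  assumes "f differentiable (at x)" "g differentiable (at x)"
  shows "frechet_derivative (\<lambda>x. (f x, g x)) (at x)
       = (\<lambda>v. (frechet_derivative f (at x) v, frechet_derivative g (at x) v))"
  using assms
  by (intro frechet_derivative_at[symmetric] has_derivative_Pair)
     (simp_all add: frechet_derivative_works)

lemma differentiable_Pair_iff:
  "(\<lambda>x. (f x, g x)) differentiable (at x) \<longleftrightarrow> f differentiable (at x) \<and> g differentiable (at x)"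
proof
  assume "(\<lambda>x. (f x, g x)) differentiable (at x)"
  then obtain D where "((\<lambda>x. (f x, g x)) has_derivative D) (at x)"
    by (auto simp: differentiable_def)
  from has_derivative_fst[OF this] has_derivative_snd[OF this]
  show "f differentiable (at x) \<and> g differentiable (at x)"
    by (auto simp: differentiable_def)
qed (auto simp: differentiable_def intro!: has_derivative_Pair)

text \<open>Smoothness is a conjunct of \<open>infinity_harmonic\<close>, so it too must pass from
  the pair to its components and back.\<close>

lemma times_differentiable_Pair_iff:
  "times_differentiable k (\<lambda>x. (f x, g x)) \<longleftrightarrow> times_differentiable k f \<and> times_differentiable k g"
proof (induction k arbitrary: f g)
  case 0
  show ?case
    by (auto intro: continuous_on_Pair dest: continuous_on_fst continuous_on_snd)
next
  case (Suc k)
  show ?case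
  \<comment> \<open>The derivative of the pair splits only where both components are differentiable;
    if one fails somewhere, both sides are false.\<close>
  proof (cases "\<forall>x. f differentiable (at x) \<and> g differentiable (at x)")
    case True
    then show ?thesis
      by (auto simp: differentiable_Pair_iff frechet_derivative_Pair Suc)
  next
    case False
    then show ?thesis
      by (auto simp: differentiable_Pair_iff)
  qed
qed

lemma smooth_map_Pair_iff:
  "smooth_map (\<lambda>x. (f x, g x)) \<longleftrightarrow> smooth_map f \<and> smooth_map g"
  by (auto simp: smooth_map_def times_differentiable_Pair_iff)

lemma smooth_map_differentiable:
  assumes "smooth_map f"
  shows "f differentiable (at x)"
  using assms unfolding smooth_map_def by (metis times_differentiable.simps(2))

lemma smooth_map_frechet_derivative:
  assumes "smooth_map f"
  shows "smooth_map (\<lambda>x. frechet_derivative f (at x) v)"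
  using assms unfolding smooth_map_def by (metis times_differentiable.simps(2))

lemma differentiable_energy_density:
  assumes "smooth_map f"
  shows "energy_density f differentiable (at x)"
  unfolding energy_density_def[abs_def]
  using smooth_map_differentiable[OF smooth_map_frechet_derivative[OF assms]]
  by (intro differentiable_sum differentiable_inner) auto

lemma energy_density_Pair:
  assumes "f differentiable (at x)" "g differentiable (at x)"
  shows "energy_density (\<lambda>x. (f x, g x)) x = energy_density f x + energy_density g x"
  by (simp add: energy_density_def frechet_derivative_Pair[OF assms] inner_prod_def sum.distrib)

text \<open>Uniqueness for the \<open>THE\<close> in \<open>grad\<close>: derivatives are unique and
  the inner product is nondegenerate.\<close>

lemma grad_eqI:
  assumes "GDERIV h x :> D"
  shows "grad h x = D"
  unfolding grad_def
proof (rule the_equality, fact assms)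
  fix D' assume "GDERIV h x :> D'"
  with assms have "(\<lambda>v. v \<bullet> D') = (\<lambda>v. v \<bullet> D)"
    unfolding gderiv_def by (rule has_derivative_unique[rotated])
  then show "D' = D"
    by (metis euclidean_eqI inner_commute)
qed

lemma GDERIV_grad:
  fixes h :: "'a::euclidean_space \<Rightarrow> real"
  assumes "h differentiable (at x)"
  shows "GDERIV h x :> grad h x"
proof -
  obtain D where D: "(h has_derivative D) (at x)"
    using assms by (auto simp: differentiable_def)
  interpret linear D
    using D by (rule has_derivative_linear)
  \<comment> \<open>Riesz representation: the coordinate of the gradient along \<open>b\<close> is
    \<open>D b\<close>.\<close>
  have "D v = v \<bullet> (\<Sum>b\<in>Basis. D b *\<^sub>R b)" for v
    by (subst (1) euclidean_representation[symmetric, of v])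
       (simp add: sum scale inner_sum_right mult.commute)
  then have "D = (\<lambda>v. v \<bullet> (\<Sum>b\<in>Basis. D b *\<^sub>R b))"
    by (rule ext)
  with D have "GDERIV h x :> (\<Sum>b\<in>Basis. D b *\<^sub>R b)"
    by (simp add: gderiv_def)
  then show ?thesis
    using grad_eqI by metis
qed

lemma grad_mult_left:
  fixes h :: "'a::euclidean_space \<Rightarrow> real"
  assumes "h differentiable (at x)"
  shows "grad (\<lambda>x. c * h x) x = c *\<^sub>R grad h x"
  using has_derivative_mult_right[OF GDERIV_grad[OF assms, unfolded gderiv_def], of c]
  by (intro grad_eqI) (simp add: gderiv_def)

lemma infinity_harmonic_Pair_iff:
  assumes energy: "energy_density f = energy_density g"
  shows "infinity_harmonic (\<lambda>x. (f x, g x)) \<longleftrightarrow> infinity_harmonic f \<and> infinity_harmonic g"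
\<comment> \<open>If a component is not smooth, both sides are false; otherwise the derivative of
  the pair splits and the gradients exist.\<close>
proof (cases "smooth_map f \<and> smooth_map g")
  case True
  then have diff: "f differentiable (at x)" "g differentiable (at x)" for x
    by (auto intro: smooth_map_differentiable)
  have "energy_density (\<lambda>x. (f x, g x)) = (\<lambda>x. 2 * energy_density g x)"
    by (simp add: fun_eq_iff energy_density_Pair diff energy)
  then have "grad (energy_density (\<lambda>x. (f x, g x))) x = 2 *\<^sub>R grad (energy_density g) x" for x
    using True by (simp add: grad_mult_left differentiable_energy_density)
  \<comment> \<open>Derivatives are linear, so the factor 2 comes out and does not affect
    vanishing.\<close>
  then show ?thesis
    using True
    by (auto simp: infinity_harmonic_def smooth_map_Pair_iff frechet_derivative_Pair diff energy
        linear_cmul[OF linear_frechet_derivative] zero_prod_def)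
next
  case False
  then show ?thesis
    by (auto simp: infinity_harmonic_def smooth_map_Pair_iff)
qed

lemma sum_Basis_Times:
  fixes h :: "'a::euclidean_space \<times> 'b::euclidean_space \<Rightarrow> 'c::comm_monoid_add"
  shows "sum h Basis = (\<Sum>b\<in>Basis. h (b, 0)) + (\<Sum>b\<in>Basis. h (0, b))"
  unfolding Basis_prod_def
  by (subst sum.union_disjoint) (auto simp: sum.reindex inj_on_def)

text \<open>J exchanges the vectors \<open>(b, 0)\<close> and \<open>(0, b)\<close> up to sign, so
  the two halves of the trace are swapped and the signs disappear in the squared norms.\<close>

lemma energy_density_eq_if_Cauchy_Riemann:
  fixes f g :: "'a::euclidean_space \<times> 'a \<Rightarrow> 'b::euclidean_space"
  assumes f: "(f has_derivative f') (at x)" and g: "(g has_derivative g') (at x)"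
    and CR: "\<And>X Y. f' (- Y, X) = - g' (X, Y)"
  shows "energy_density f x = energy_density g x"
proof -
  have "f' (0, b) = - g' (b, 0)" for b
    \<comment> \<open>\<open>Y\<close> occurs first in \<open>CR\<close>, so this is
      \<open>Y = 0\<close> and \<open>X = b\<close>.\<close>
    using CR[of 0 b] by simp
  moreover have "f' (b, 0) = g' (0, b)" for b
    using CR[of b 0] linear_neg[OF has_derivative_linear[OF f], of "(b, 0)"] by simp
  ultimately show ?thesis
    by (simp add: energy_density_def frechet_derivative_at[OF f, symmetric]
        frechet_derivative_at[OF g, symmetric] sum_Basis_Times add.commute)
qed

theorem theorem8p1:
  fixes F :: "complex ^ 'm \<Rightarrow> complex ^ 'n"
    and \<phi> \<psi> :: "(real ^ 'm) \<times> (real ^ 'm) \<Rightarrow> real ^ 'n"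
  assumes "holomorphic_map F"
    and "\<And>X Y. F (cvec (X, Y)) = cvec (\<phi> (X, Y), \<psi> (X, Y))"
  shows "infinity_harmonic (realify F) \<longleftrightarrow> infinity_harmonic \<phi> \<and> infinity_harmonic \<psi>"
proof -
  have realify: "realify F = (\<lambda>p. (\<phi> p, \<psi> p))"
    by (auto simp: realify_def assms(2))
  have "energy_density \<phi> p = energy_density \<psi> p" for p
  proof -
    obtain F' where F': "(F has_derivative F') (at (cvec p))" "\<And>c v. F' (c *s v) = c *s F' v"
      using assms(1) unfolding holomorphic_map_def by blast
    \<comment> \<open>Chain rule: \<open>rvec\<close> and \<open>cvec\<close> are real linear, hence
      their own derivatives.\<close>
    have "((\<lambda>q. rvec (F (cvec q))) has_derivative (\<lambda>v. rvec (F' (cvec v)))) (at p)"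
      using linear_rvec linear_cvec F'(1)
      by (metis bounded_linear.has_derivative bounded_linear_imp_has_derivative
          has_derivative_compose linear_conv_bounded_linear)
    then have "((\<lambda>q. (\<phi> q, \<psi> q)) has_derivative (\<lambda>v. rvec (F' (cvec v)))) (at p)"
      using realify by (simp add: realify_def comp_def)
    from has_derivative_fst[OF this] has_derivative_snd[OF this]
    have "(\<phi> has_derivative (\<lambda>v. fst (rvec (F' (cvec v))))) (at p)"
      and "(\<psi> has_derivative (\<lambda>v. snd (rvec (F' (cvec v))))) (at p)"
      by simp_all
    \<comment> \<open>Complex linearity gives F'(iz) = i F'(z), and Re(iw) = - Im w turns this into
      the Cauchy-Riemann equations.\<close>
    then show ?thesis
      by (rule energy_density_eq_if_Cauchy_Riemann)
         (simp add: cvec_rotate F'(2) rvec_def vec_eq_iff)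
  qed
  then show ?thesis
    unfolding realify by (intro infinity_harmonic_Pair_iff) auto
qed

end
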